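(* There exist an element $w$ of the free group $F_2$ of rank $2$ and an automorphism $\varphi\in\operatorname{Aut}(F_2)$ such that $\langle w,\varphi(w),\varphi^2(w)\rangle=F_2$ but $\langle w,\varphi(w)\rangle\ne F_2$. Hence the assertion "for $w\in F_n$ and $\varphi\in\operatorname{Aut}(F_n)$, $\langle w,\varphi(w),\dots,\varphi^n(w)\rangle=F_n$ implies $\langle w,\varphi(w),\dots,\varphi^{n-1}(w)\rangle=F_n$" fails for $n=2$.
   Context: $F_n$ denotes the free group of rank $n$. *)

theory Defs
  imports "HOL-Algebra.Algebra"
begin

(* The letter (i, True) is the i-th free generator and (i, False) is its formal inverse. *)
type_synonym letter = "nat \<times> bool"

definition inv_letter :: "letter \<Rightarrow> letter" where
  "inv_letter x = (fst x, \<not> snd x)"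

definition reduced :: "letter list \<Rightarrow> bool" where
  "reduced w \<longleftrightarrow> successively (\<lambda>x y. y \<noteq> inv_letter x) w"

(* For reduced w, push x w is the reduced form of the word x # w. *)
fun push :: "letter \<Rightarrow> letter list \<Rightarrow> letter list" where
  "push x [] = [x]"
| "push x (y # ys) = (if y = inv_letter x then ys else x # y # ys)"

(* For a reduced word v, foldr push u v is the reduced form of u @ v. *)
definition free_group :: "nat \<Rightarrow> letter list monoid" where
  "free_group n =
    \<lparr>carrier = {w. reduced w \<and> fst ` set w \<subseteq> {..<n}},
     monoid.mult = (\<lambda>u v. foldr push u v),
     one = []\<rparr>"

definition free_gen :: "nat \<Rightarrow> letter list" where
  "free_gen i = [(i, True)]"

definition iterate_generation_property :: "nat \<Rightarrow> bool" where
  "iterate_generation_property n \<longleftrightarrow>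
    (\<forall>w \<in> carrier (free_group n). \<forall>\<phi> \<in> auto (free_group n).
      generate (free_group n) {(\<phi> ^^ i) w | i. i \<le> n} = carrier (free_group n) \<longrightarrow>
      generate (free_group n) {(\<phi> ^^ i) w | i. i < n} = carrier (free_group n))"

lemma inv_letter_invol [simp]: "inv_letter (inv_letter x) = x"
  by (simp add: inv_letter_def)

lemma inv_letter_neq [simp]: "inv_letter x \<noteq> x" "x \<noteq> inv_letter x"
  by (auto simp: inv_letter_def prod_eq_iff)

lemma fst_inv_letter [simp]: "fst (inv_letter x) = fst x"
  by (simp add: inv_letter_def)

lemma reduced_Nil [simp]: "reduced []"
  by (simp add: reduced_def)

lemma reduced_Cons: "reduced (x # w) \<longleftrightarrow> reduced w \<and> (w = [] \<or> hd w \<noteq> inv_letter x)"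
  by (auto simp: reduced_def successively_Cons)

lemma reduced_push: "reduced w \<Longrightarrow> reduced (push x w)"
  by (cases w) (auto simp: reduced_Cons)

lemma set_push: "set (push x w) \<subseteq> insert x (set w)"
  by (cases w) auto

lemma push_inv: "reduced w \<Longrightarrow> push x (push (inv_letter x) w) = w"
  by (cases w; cases "tl w") (auto simp: reduced_Cons)

lemma push_inv': "reduced w \<Longrightarrow> push (inv_letter x) (push x w) = w"
  using push_inv[of w "inv_letter x"] by simp

lemma push_reduced: "reduced (x # w) \<Longrightarrow> push x w = x # w"
  by (cases w) (auto simp: reduced_Cons)

lemma reduced_foldr_push: "reduced v \<Longrightarrow> reduced (foldr push u v)"
  by (induction u) (auto simp: reduced_push)

lemma set_foldr_push: "set (foldr push u v) \<subseteq> set u \<union> set v"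
proof (induction u)
  case (Cons x u)
  then show ?case using set_push[of x "foldr push u v"] by auto
qed simp

lemma foldr_push_push:
  assumes "reduced w"
  shows "foldr push (push x u) w = push x (foldr push u w)"
  by (cases u) (auto simp: push_inv reduced_foldr_push assms)

lemma foldr_push_assoc:
  assumes "reduced w"
  shows "foldr push (foldr push u v) w = foldr push u (foldr push v w)"
  by (induction u) (auto simp: foldr_push_push assms)

lemma foldr_push_Nil: "reduced u \<Longrightarrow> foldr push u [] = u"
  by (induction u) (auto simp: reduced_Cons push_reduced)

lemma foldr_push_rev_inv:
  "reduced v \<Longrightarrow> foldr push (rev (map inv_letter u)) (foldr push u v) = v"
  by (induction u arbitrary: v) (auto simp: push_inv' reduced_foldr_push)

lemma group_free_group: "group (free_group n)"
proof (rule groupI)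
  fix u v assume "u \<in> carrier (free_group n)" "v \<in> carrier (free_group n)"
  then show "u \<otimes>\<^bsub>free_group n\<^esub> v \<in> carrier (free_group n)"
    using image_mono[OF set_foldr_push[of u v], of fst]
    by (simp add: free_group_def reduced_foldr_push image_Un) blast
next
  fix u assume u: "u \<in> carrier (free_group n)"
  let ?v = "foldr push (rev (map inv_letter u)) []"
  have "?v \<in> carrier (free_group n)"
    using u set_foldr_push[of "rev (map inv_letter u)" "[]"]
    by (fastforce simp: free_group_def reduced_foldr_push)
  moreover have "?v \<otimes>\<^bsub>free_group n\<^esub> u = \<one>\<^bsub>free_group n\<^esub>"
    using u foldr_push_rev_inv[of "[]" u]
    by (simp add: free_group_def foldr_push_assoc foldr_push_Nil)
  ultimately show "\<exists>v\<in>carrier (free_group n). v \<otimes>\<^bsub>free_group n\<^esub> u = \<one>\<^bsub>free_group n\<^esub>" ..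
qed (auto simp: free_group_def foldr_push_assoc)

lemma free_gen_closed: "i < n \<Longrightarrow> free_gen i \<in> carrier (free_group n)"
  by (auto simp: free_gen_def free_group_def reduced_def)

lemma inv_free_gen:
  assumes "i < n"
  shows "inv\<^bsub>free_group n\<^esub> (free_gen i) = [(i, False)]"
proof -
  interpret group "free_group n" by (rule group_free_group)
  show ?thesis
    by (rule inv_equality)
      (use assms in \<open>auto simp: free_gen_def free_group_def reduced_def inv_letter_def\<close>)
qed

(* The universal property: free_group n is free on the n elements free_gen 0, ..., free_gen (n - 1). *)
lemma free_group_hom_exists:
  assumes "group G" and f: "f \<in> {..<n} \<rightarrow> carrier G"
  shows "\<exists>h \<in> hom (free_group n) G. \<forall>i<n. h (free_gen i) = f i"
proof -
  interpret group G by fact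
  define l where "l x = (if snd x then f (fst x) else inv\<^bsub>G\<^esub> f (fst x))" for x :: letter
  define h where "h w = foldr (\<lambda>x g. l x \<otimes>\<^bsub>G\<^esub> g) w \<one>\<^bsub>G\<^esub>" for w
  have l: "l x \<in> carrier G" if "fst x < n" for x
    using f that by (auto simp: l_def)
  have l_inv: "l (inv_letter x) = inv\<^bsub>G\<^esub> l x" if "fst x < n" for x
    using f that by (auto simp: l_def inv_letter_def Pi_iff)
  have h: "h w \<in> carrier G" if "fst ` set w \<subseteq> {..<n}" for w
    using that by (induction w) (auto simp: h_def l)
  have h_push: "h (push x w) = l x \<otimes>\<^bsub>G\<^esub> h w"
    if "fst x < n" "fst ` set w \<subseteq> {..<n}" for x w
  proof (cases "w \<noteq> [] \<and> hd w = inv_letter x")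
    case True
    then obtain ys where w: "w = inv_letter x # ys" by (cases w) auto
    with that h[of ys] l[of x] show ?thesis
      by (simp add: h_def l_inv m_assoc[symmetric])
  next
    case False
    then have "push x w = x # w" by (cases w) auto
    then show ?thesis by (simp add: h_def)
  qed
  have h_mult: "h (foldr push u v) = h u \<otimes>\<^bsub>G\<^esub> h v"
    if "fst ` set u \<subseteq> {..<n}" "fst ` set v \<subseteq> {..<n}" for u v
    using that
  proof (induction u)
    case Nil
    then show ?case using h[of v] by (simp add: h_def)
  next
    case (Cons x u)
    have "fst ` set (foldr push u v) \<subseteq> {..<n}"
      using Cons.prems set_foldr_push[of u v] by fastforce
    moreover have "h (x # u) = l x \<otimes>\<^bsub>G\<^esub> h u" by (simp add: h_def)
    ultimately show ?case
      using Cons by (simp add: h_push h l m_assoc)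
  qed
  have "h \<in> hom (free_group n) G"
    by (rule homI) (auto simp: free_group_def h h_mult)
  moreover have "h (free_gen i) = f i" if "i < n" for i
    using that f by (simp add: h_def free_gen_def l_def Pi_iff)
  ultimately show ?thesis by blast
qed

lemma generate_free_gen: "generate (free_group n) (free_gen ` {..<n}) = carrier (free_group n)"
proof -
  interpret group "free_group n" by (rule group_free_group)
  let ?S = "free_gen ` {..<n}"
  have letter: "[x] \<in> generate (free_group n) ?S" if "fst x < n" for x
    using generate.incl[of "free_gen (fst x)" ?S "free_group n"]
      generate.inv[of "free_gen (fst x)" ?S "free_group n"] inv_free_gen[OF that] that
    by (cases x; cases "snd x") (auto simp: free_gen_def)
  have "w \<in> generate (free_group n) ?S" if "reduced w" "fst ` set w \<subseteq> {..<n}" for w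
    using that
  proof (induction w)
    case Nil
    then show ?case using generate.one[of "free_group n" ?S] by (simp add: free_group_def)
  next
    case (Cons x w)
    then have "[x] \<otimes>\<^bsub>free_group n\<^esub> w \<in> generate (free_group n) ?S"
      by (intro generate.eng letter) (auto simp: reduced_Cons)
    then show ?case using Cons.prems by (simp add: free_group_def push_reduced)
  qed
  moreover have "generate (free_group n) ?S \<subseteq> carrier (free_group n)"
    by (rule generate_incl) (auto simp: free_gen_closed)
  ultimately show ?thesis by (auto simp: free_group_def)
qed

end

theory Submission
  imports Defs
begin

text \<open>Write \<open>a\<close>, \<open>b\<close> for the free generators. Let \<open>\<phi>\<close> be the automorphism \<open>a \<mapsto> b\<close>, \<open>b \<mapsto> ab\<close>
  and \<open>w = a b a\<inverse> b\<inverse> a\<close>. Then \<open>\<phi>(w) = b a b\<inverse> a\<inverse> b\<close> and \<open>\<phi>\<^sup>2(w) = w b\<close>, so the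
  three elements generate \<open>b = w\<inverse> \<phi>\<^sup>2(w)\<close> and then \<open>a = \<phi>(w) b\<inverse> w\<close>. On the other hand, letting
  \<open>a\<close> act as the transposition \<open>(1 2)\<close> and \<open>b\<close> as the 3-cycle \<open>(1 2)(1 3)\<close>, both \<open>w\<close> and
  \<open>\<phi>(w)\<close> fix the point 1, while \<open>a\<close> does not.\<close>

text \<open>Homomorphisms commute with every constructor of \<open>generate\<close>, so induction
  applies. It serves to verify that two endomorphisms are mutually inverse by looking at generators
  only.\<close>

lemma (in group) hom_eq_on_generate:
  assumes "group H" "h \<in> hom G H" "k \<in> hom G H" "S \<subseteq> carrier G"
    and eq: "\<And>s. s \<in> S \<Longrightarrow> h s = k s" and x: "x \<in> generate G S"
  shows "h x = k x"
proof -
  interpret h: group_hom G H h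
    using assms by (simp add: group_hom_def group_hom_axioms_def)
  interpret k: group_hom G H k
    using assms by (simp add: group_hom_def group_hom_axioms_def)
  from x show ?thesis
  proof induction
    case one
    then show ?case by simp
  next
    case (incl s)
    then show ?case by (rule eq)
  next
    case (inv s)
    then show ?case using eq \<open>S \<subseteq> carrier G\<close> by (simp add: subset_iff)
  next
    case (eng x y)
    then show ?case using generate_in_carrier[OF \<open>S \<subseteq> carrier G\<close>] by simp
  qed
qed

text \<open>Since \<open>h g\<close> is a bijection, its inverse fixes \<open>i\<close> whenever
  \<open>h g\<close> does. Such stabilizers certify that a generated subgroup is proper.\<close>

lemma subgroup_point_stabilizer:
  assumes "group G" "h \<in> hom G (sym_group n)"
  shows "subgroup {g \<in> carrier G. h g i = i} G"
proof -
  interpret group_hom G "sym_group n" h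
    using assms sym_group_is_group by (simp add: group_hom_def group_hom_axioms_def)
  show ?thesis
  proof (rule G.subgroupI)
    have "\<one>\<^bsub>G\<^esub> \<in> {g \<in> carrier G. h g i = i}"
      by (simp add: sym_group_one)
    then show "{g \<in> carrier G. h g i = i} \<noteq> {}" by blast
  next
    fix g assume g: "g \<in> {g \<in> carrier G. h g i = i}"
    then have "bij (h g)"
      using hom_closed[of g] by (auto simp: sym_group_carrier permutes_bij)
    then show "inv\<^bsub>G\<^esub> g \<in> {g \<in> carrier G. h g i = i}"
      using g bij_inv_eq_iff[of "h g" i i] hom_closed[of g] by auto
  qed (auto simp: sym_group_mult)
qed

theorem mainTheorem8:
  shows "(\<exists>w \<in> carrier (free_group 2). \<exists>\<phi> \<in> auto (free_group 2).
            generate (free_group 2) {w, \<phi> w, \<phi> (\<phi> w)} = carrier (free_group 2) \<and>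
            generate (free_group 2) {w, \<phi> w} \<noteq> carrier (free_group 2)) \<and>
         \<not> iterate_generation_property 2"
proof -
  let ?F = "free_group 2"
  interpret F: group ?F by (rule group_free_group)
  define a b where "a = free_gen 0" and "b = free_gen 1"
  have ab [simp]: "a \<in> carrier ?F" "b \<in> carrier ?F"
    by (simp_all add: a_def b_def free_gen_closed)
  have gens: "free_gen ` {..<2} = {a, b}"
    by (auto simp: a_def b_def lessThan_nat_numeral lessThan_Suc numeral_2_eq_2)

  have hom_exists: "\<exists>h \<in> hom ?F H. h a = x \<and> h b = y"
    if H: "group H" "x \<in> carrier H" "y \<in> carrier H" for H :: "'c monoid" and x y
  proof -
    let ?xy = "\<lambda>i::nat. if i = 0 then x else y"
    obtain h where "h \<in> hom ?F H" and h: "\<forall>i<2. h (free_gen i) = ?xy i"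
      using free_group_hom_exists[OF H(1), of ?xy 2] H(2,3) by auto
    moreover have "h a = x" "h b = y"
      using h by (simp_all add: a_def b_def)
    ultimately show ?thesis by blast
  qed
  obtain f where f: "f \<in> hom ?F ?F" "f a = b" "f b = a \<otimes>\<^bsub>?F\<^esub> b"
    using hom_exists[OF F.is_group, of b "a \<otimes>\<^bsub>?F\<^esub> b"] by auto
  \<comment> \<open>Solving \<open>f a = b\<close> and \<open>f b = ab\<close> for the generators
    gives a = f(b) f(a)^-1 and b = f(a), which dictates the values of the inverse
    \<open>g\<close>.\<close>
  obtain g where g: "g \<in> hom ?F ?F" "g a = b \<otimes>\<^bsub>?F\<^esub> inv\<^bsub>?F\<^esub> a" "g b = a"
    using hom_exists[OF F.is_group, of "b \<otimes>\<^bsub>?F\<^esub> inv\<^bsub>?F\<^esub> a" a] by auto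
  interpret f: group_hom ?F ?F f
    using f(1) by unfold_locales
  interpret g: group_hom ?F ?F g
    using g(1) by unfold_locales
  have id_if_fixes_gens: "k x = x"
    if "k \<in> hom ?F ?F" "k a = a" "k b = b" "x \<in> carrier ?F" for k x
    using F.hom_eq_on_generate[OF F.is_group that(1), of id "{a, b}" x] that
      generate_free_gen[of 2] by (auto simp: gens hom_def)
  have gf: "g (f x) = x" if "x \<in> carrier ?F" for x
    using id_if_fixes_gens[OF hom_compose[OF f(1) g(1)] _ _ that] f g
    by (simp add: F.m_assoc)
  have fg: "f (g x) = x" if "x \<in> carrier ?F" for x
    using id_if_fixes_gens[OF hom_compose[OF g(1) f(1)] _ _ that] f g
    by (simp add: F.m_assoc)
  \<comment> \<open>Members of \<open>auto\<close> must be extensional, whereas \<open>f\<close> is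
    unconstrained outside the carrier.\<close>
  define \<phi> where "\<phi> = restrict f (carrier ?F)"
  have \<phi>: "\<phi> \<in> auto ?F"
  proof -
    have "bij_betw f (carrier ?F) (carrier ?F)"
      by (rule bij_betw_byWitness[where f' = g]) (auto simp: gf fg)
    then have "bij_betw \<phi> (carrier ?F) (carrier ?F)"
      by (simp add: \<phi>_def cong: bij_betw_cong)
    then show ?thesis
      by (simp add: auto_def Bij_def \<phi>_def hom_def)
  qed

  define w where "w = a \<otimes>\<^bsub>?F\<^esub> b \<otimes>\<^bsub>?F\<^esub> inv\<^bsub>?F\<^esub> a \<otimes>\<^bsub>?F\<^esub> inv\<^bsub>?F\<^esub> b \<otimes>\<^bsub>?F\<^esub> a"
  define v where "v = b \<otimes>\<^bsub>?F\<^esub> a \<otimes>\<^bsub>?F\<^esub> inv\<^bsub>?F\<^esub> b \<otimes>\<^bsub>?F\<^esub> inv\<^bsub>?F\<^esub> a \<otimes>\<^bsub>?F\<^esub> b"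
  have wv [simp]: "w \<in> carrier ?F" "v \<in> carrier ?F"
    by (simp_all add: w_def v_def)
  \<comment> \<open>Together with associativity and the inverse of a product, these rules let the
    simplifier freely reduce right-nested words.\<close>
  have cancel: "x \<otimes>\<^bsub>?F\<^esub> (inv\<^bsub>?F\<^esub> x \<otimes>\<^bsub>?F\<^esub> y) = y" "inv\<^bsub>?F\<^esub> x \<otimes>\<^bsub>?F\<^esub> (x \<otimes>\<^bsub>?F\<^esub> y) = y"
    if "x \<in> carrier ?F" "y \<in> carrier ?F" for x y
    using that by (simp_all flip: F.m_assoc)
  have \<phi>w: "\<phi> w = v"
    by (simp add: \<phi>_def w_def v_def f F.m_assoc F.inv_mult_group cancel)
  have \<phi>v: "\<phi> v = w \<otimes>\<^bsub>?F\<^esub> b"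
    by (simp add: \<phi>_def w_def v_def f F.m_assoc F.inv_mult_group cancel)

  have gen3: "generate ?F {w, \<phi> w, \<phi> (\<phi> w)} = carrier ?F"
  proof
    let ?S = "{w, \<phi> w, \<phi> (\<phi> w)}"
    show "generate ?F ?S \<subseteq> carrier ?F"
      by (rule F.generate_incl) (simp add: \<phi>w \<phi>v)
    interpret S: subgroup "generate ?F ?S" ?F
      by (rule F.generate_is_subgroup) (simp add: \<phi>w \<phi>v)
    have S: "w \<in> generate ?F ?S" "v \<in> generate ?F ?S" "w \<otimes>\<^bsub>?F\<^esub> b \<in> generate ?F ?S"
      by (auto intro: generate.incl simp: \<phi>w \<phi>v)
    have b_eq: "inv\<^bsub>?F\<^esub> w \<otimes>\<^bsub>?F\<^esub> (w \<otimes>\<^bsub>?F\<^esub> b) = b"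
      by (simp add: cancel)
    have b: "b \<in> generate ?F ?S"
      using S.m_closed[OF S.m_inv_closed[OF S(1)] S(3)] unfolding b_eq .
    \<comment> \<open>With [x,y] = x y x^-1 y^-1, the factor v b^-1 is [b,a] and w = [a,b] a, so the
      two commutators cancel.\<close>
    have a_eq: "v \<otimes>\<^bsub>?F\<^esub> inv\<^bsub>?F\<^esub> b \<otimes>\<^bsub>?F\<^esub> w = a"
      by (simp only: w_def v_def F.m_assoc cancel ab F.m_closed F.inv_closed)
    have a: "a \<in> generate ?F ?S"
      using S.m_closed[OF S.m_closed[OF S(2) S.m_inv_closed[OF b]] S(1)] unfolding a_eq .
    have "generate ?F {a, b} \<subseteq> generate ?F ?S"
      by (rule F.generate_subgroup_incl[OF _ S.subgroup_axioms]) (use a b in blast)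
    then show "carrier ?F \<subseteq> generate ?F ?S"
      unfolding generate_free_gen[of 2, unfolded gens] .
  qed

  have gen2: "generate ?F {w, \<phi> w} \<noteq> carrier ?F"
  proof
    assume eq: "generate ?F {w, \<phi> w} = carrier ?F"
    \<comment> \<open>Writing \<open>r\<close> as a product of transpositions makes its inverse the
      reversed product; \<open>r\<close> maps 1 to 3, 3 to 2 and 2 to 1.\<close>
    define s r where "s = transpose 1 (2::nat)" and "r = s \<circ> transpose 1 (3::nat)"
    have sr: "s \<in> carrier (sym_group 3)" "r \<in> carrier (sym_group 3)"
      by (auto simp: s_def r_def sym_group_carrier intro!: permutes_compose permutes_swap_id)
    have s_inv: "inv\<^bsub>sym_group 3\<^esub> s = s"
      using sr by (simp add: s_def)
    have r_inv: "inv\<^bsub>sym_group 3\<^esub> r = transpose 1 3 \<circ> s"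
      using sr by (simp add: r_def s_def o_inv_distrib)
    obtain h where h: "h \<in> hom ?F (sym_group 3)" "h a = s" "h b = r"
      using hom_exists[OF sym_group_is_group sr] by auto
    interpret h: group_hom ?F "sym_group 3" h
      using h(1) sym_group_is_group by (simp add: group_hom_def group_hom_axioms_def F.is_group)
    let ?K = "{x \<in> carrier ?F. h x 1 = 1}"
    \<comment> \<open>The rightmost letter acts first: the point 1 travels 1, 2, 3, 3, 2, 1 under
      \<open>w\<close> and 1, 3, 3, 1, 2, 1 under \<open>v\<close>.\<close>
    have "w \<in> ?K" "v \<in> ?K"
      by (simp_all add: w_def v_def h s_inv r_inv sym_group_mult)
        (simp_all add: r_def s_def transpose_def)
    then have "generate ?F {w, \<phi> w} \<subseteq> ?K"
      by (intro F.generate_subgroup_incl[OF _ subgroup_point_stabilizer[OF F.is_group h(1)]])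
        (simp add: \<phi>w)
    then have "a \<in> ?K"
      unfolding eq using ab(1) by (rule subsetD)
    then have "h a 1 = 1"
      by simp
    then show False
      by (simp add: h s_def)
  qed

  have "{(\<phi> ^^ i) w | i. i \<le> 2} = {w, \<phi> w, \<phi> (\<phi> w)}"
  proof -
    have "{(\<phi> ^^ i) w | i. i \<le> 2} = (\<lambda>i. (\<phi> ^^ i) w) ` {..2}" by auto
    also have "{..2} = {0, 1, 2::nat}" by auto
    finally show ?thesis by (simp add: numeral_2_eq_2)
  qed
  moreover have "{(\<phi> ^^ i) w | i. i < 2} = {w, \<phi> w}"
  proof -
    have "{(\<phi> ^^ i) w | i. i < 2} = (\<lambda>i. (\<phi> ^^ i) w) ` {..<2}" by auto
    also have "{..<2} = {0, 1::nat}" by auto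
    finally show ?thesis by simp
  qed
  ultimately have "\<not> iterate_generation_property 2"
    unfolding iterate_generation_property_def
    by (intro notI) (drule bspec[OF _ wv(1)], drule bspec[OF _ \<phi>], simp only: gen2 gen3, simp)
  then show ?thesis
    by (intro conjI bexI[OF _ wv(1)] bexI[OF _ \<phi>] gen2 gen3)
qed

end
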